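(* Consider the symmetric rigid body with rotor ($I_1=I_2$). The maximal $\theta$ that can be reached with rotor on from $\mathbf{L}=(l,0,0)$ is given by \[ \cos\theta_{max}=\sqrt{\beta^2+1}-\beta,\qquad \beta=\frac{\rho}{\gamma}. \] The inverse relation is \[ \beta=\frac{s^2}{2\sqrt{1-s^2}},\qquad s=\sin\theta_{max}. \] The time $T_2$ to move with rotor on from the point $\mathbf{L}=(l,0,0)$ to the point $\mathbf{L}=l(0,\cos\theta_{max},\sin\theta_{max})$ is given by \[ \frac{l}{I_1}T_2=\hat T_2=\frac{2k}{s\gamma}K(k^2),\qquad k^2=\frac{1-s^2}{2-s^2}. \]
   Context: A rigid body with principal moments of inertia $I_1=I_2$ and $I_3$ carries a rotor (a disc rotating about the body's 2-axis). When the rotor is on it produces the constant internal angular momentum $(0,h,0)^t$ in the body frame. The total angular momentum is constant in space, equal to $(l,0,0)^t$. The dimensionless parameters are $\gamma=I_1/I_3-1$ and $\rho=h/l$. With somersault angle $\phi$, tilt angle $\theta$ and twist angle $\psi$, the angular momentum in the body frame is $\mathbf{L}=l(\cos\theta\cos\psi,-\cos\theta\sin\psi,\sin\theta)$. In dimensionless time $\tau=tl/I_1$ (prime denotes $d/d\tau$) the equations of motion with rotor on are $\phi'=1+\rho\sec\theta\sin\psi$, $\theta'=-\rho\cos\psi$, $\psi'=\gamma\sin\theta-\rho\tan\theta\sin\psi$, with conserved dimensionless energy $E=\frac12(1+\gamma\sin^2\theta)+\frac12\rho(\rho+2\cos\theta\sin\psi)$. A hat denotes dimensionless time, $\hat T_2=lT_2/I_1$.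 $K(k^2)=\int_0^{\pi/2}d\alpha/\sqrt{1-k^2\sin^2\alpha}$ is Legendre's complete elliptic integral of the first kind, and $k$ is the positive root of $k^2$.
   Formalization: Assumes β>0 (else cos θmax>1 or degenerate) and uses |γ| in T2; as θ'=-ρcosψ, for ρ>0 the motion from (l,0,0) first reaches l(0,cos θmax,-sin θmax), so T2 is the shortest time between the printed points in either direction, and the first arrival time at l(0,cos θmax,-sgn(ρ) sin θmax). *)

theory Defs
  imports "HOL-Analysis.Analysis"
begin

definition ang_mom :: "real \<Rightarrow> real \<Rightarrow> real \<Rightarrow> real^3" where
  "ang_mom l \<theta> \<psi> = vector [l * (cos \<theta> * cos \<psi>), - l * (cos \<theta> * sin \<psi>), l * sin \<theta>]"

text \<open>
  The angles are functions of the dimensionless time \<open>\<tau> = t l / I1\<close>, with the rotor on throughout.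
  The tilt angle ranges over the open interval between \<open>-\<pi>/2\<close> and \<open>\<pi>/2\<close>, where
  secant and tangent are defined; this also fixes the otherwise ambiguous choice of angles for a
  given angular momentum vector (up to multiples of \<open>2\<pi>\<close> in \<open>\<psi>\<close>).
\<close>

definition rotor_on_motion ::
  "real \<Rightarrow> real \<Rightarrow> (real \<Rightarrow> real) \<Rightarrow> (real \<Rightarrow> real) \<Rightarrow> (real \<Rightarrow> real) \<Rightarrow> bool" where
  "rotor_on_motion \<gamma> \<rho> \<phi> \<theta> \<psi> \<longleftrightarrow>
     (\<forall>\<tau>. - (pi / 2) < \<theta> \<tau> \<and> \<theta> \<tau> < pi / 2 \<and>
          (\<phi> has_real_derivative 1 + \<rho> * (1 / cos (\<theta> \<tau>)) * sin (\<psi> \<tau>)) (at \<tau>) \<and>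
          (\<theta> has_real_derivative - \<rho> * cos (\<psi> \<tau>)) (at \<tau>) \<and>
          (\<psi> has_real_derivative \<gamma> * sin (\<theta> \<tau>) - \<rho> * tan (\<theta> \<tau>) * sin (\<psi> \<tau>)) (at \<tau>))"

text \<open>The argument is the parameter \<open>m = k\<^sup>2\<close>, not the modulus \<open>k\<close>.\<close>

definition elliptic_K :: "real \<Rightarrow> real" where
  "elliptic_K m = integral {0..pi/2} (\<lambda>\<alpha>. 1 / sqrt (1 - m * (sin \<alpha>)\<^sup>2))"

text \<open>
  Two notions of the time needed between points of a trajectory. The first is the length of the
  shortest piece of the trajectory with end points \<open>P\<close> and \<open>Q\<close>, whichever of the
  two the motion runs through first; the second is the first time, starting at time 0, at which
  \<open>Q\<close> is reached.

  Both are needed because \<open>\<theta>' = -\<rho> cos \<psi>\<close> makes \<open>\<theta>\<close> decrease initially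
  from \<open>\<theta> = \<psi> = 0\<close> when \<open>\<rho> > 0\<close>. The motion then runs in one
  quarter period from \<open>(l, 0, 0)\<close> to \<open>l (0, cos \<theta>\<^sub>m\<^sub>a\<^sub>x, - sin \<theta>\<^sub>m\<^sub>a\<^sub>x)\<close>, and
  in one quarter period from \<open>l (0, cos \<theta>\<^sub>m\<^sub>a\<^sub>x, sin \<theta>\<^sub>m\<^sub>a\<^sub>x)\<close> to \<open>(l, 0, 0)\<close>. For
  \<open>\<rho> < 0\<close> the two signs are exchanged.
\<close>

definition is_transit_time :: "(real \<Rightarrow> 'a) \<Rightarrow> 'a \<Rightarrow> 'a \<Rightarrow> real \<Rightarrow> bool" where
  "is_transit_time X P Q T \<longleftrightarrow>
     (\<exists>t1 t2. X t1 = P \<and> X t2 = Q \<and> T = \<bar>t2 - t1\<bar>) \<and>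
     (\<forall>t1 t2. X t1 = P \<longrightarrow> X t2 = Q \<longrightarrow> T \<le> \<bar>t2 - t1\<bar>)"

definition is_first_arrival_time :: "(real \<Rightarrow> 'a) \<Rightarrow> 'a \<Rightarrow> real \<Rightarrow> bool" where
  "is_first_arrival_time X Q T \<longleftrightarrow>
     0 \<le> T \<and> X T = Q \<and> (\<forall>t\<ge>0. X t = Q \<longrightarrow> T \<le> t)"

end

theory Submission
  imports Defs
begin

text \<open>
  Divide the angular momentum by its length and write \<open>(X, Y, Z)\<close> for its components. The
  equations for tilt and twist become the polynomial system
  \<open>X' = Z (\<rho> + \<gamma> Y)\<close>, \<open>Y' = - \<gamma> X Z\<close>, \<open>Z' = - \<rho> X\<close>
  (\<open>rotor_on_motion_cartesian\<close>). It conserves the length \<open>X\<^sup>2 + Y\<^sup>2 + Z\<^sup>2 = 1\<close> and the energy, which in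
  these variables says that \<open>2 \<beta> Y - Z\<^sup>2\<close> is constant, namely \<open>0\<close> for a motion that starts at
  \<open>(1, 0, 0)\<close>. Hence \<open>X\<^sup>2 = 1 - Z\<^sup>2 - Z\<^sup>4 / (4 \<beta>\<^sup>2)\<close>, and \<open>\<bar>Z\<bar>\<close> is largest where \<open>X\<close> vanishes.
  There \<open>Y\<close> is the positive root \<open>c = sqrt (\<beta>\<^sup>2 + 1) - \<beta>\<close> of \<open>c\<^sup>2 + 2 \<beta> c = 1\<close>, which is
  \<open>cos \<theta>max\<close>, and \<open>\<bar>Z\<bar> = s\<close> with \<open>s\<^sup>2 = 1 - c\<^sup>2\<close>.

  In terms of \<open>s\<close> and \<open>c\<close> the quartic factors:
  \<open>s\<^sup>4 X\<^sup>2 = (s\<^sup>2 - Z\<^sup>2) (s\<^sup>2 + c\<^sup>2 Z\<^sup>2)\<close>. The substitution \<open>Z = \<mp> s cos B\<close> that rectifies the first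
  factor turns the motion into a rotation of the angle \<open>B\<close> with
  \<open>B' = \<omega> sqrt (1 - k\<^sup>2 sin\<^sup>2 B)\<close>, \<open>\<omega> = \<bar>\<gamma>\<bar> s / (2 k)\<close> (\<open>cartesian_orbit_phase\<close>), so that \<open>B\<close> is a
  Jacobi amplitude. The differential equation for \<open>B\<close> is separable: the incomplete elliptic integral
  of \<open>B\<close> grows at the constant rate \<open>\<omega>\<close>, and it increases by \<open>K(k\<^sup>2)\<close> over each quarter turn of \<open>B\<close>
  between multiples of \<open>\<pi>/2\<close>. Thus every quarter turn takes the time \<open>K(k\<^sup>2) / \<omega>\<close>
  (\<open>amplitude_at_quarter_turn_iff\<close>).

  The motion is at \<open>(l, 0, 0)\<close> only at even multiples of this quarter period, and at points with
  \<open>X = 0\<close> exactly at its odd multiples. An even and an odd integer differ by at least \<open>1\<close>, which makes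
  one quarter period the shortest transit time, and the least nonnegative odd multiple is the first
  arrival time.
\<close>

section \<open>Antiderivatives and phase angles on the real line\<close>

lemma antiderivative_on_reals:
  fixes f :: "real \<Rightarrow> real"
  assumes "continuous_on UNIV f"
  obtains F where "F a = b" and "\<And>x. (F has_real_derivative f x) (at x)"
proof -
  have "isCont f x" for x
    using assms by (simp add: continuous_on_eq_continuous_at)
  then obtain F where F: "\<And>x. (F has_real_derivative f x) (at x)"
    using einterval_antiderivative[of "-\<infinity>" "\<infinity>" f]
    by (auto simp: has_real_derivative_iff_has_vector_derivative)
  show thesis
  proof (rule that[of "\<lambda>x. F x - F a + b"])
    show "F a - F a + b = b" by simp
    show "((\<lambda>x. F x - F a + b) has_real_derivative f x) (at x)" for x
      using F by (auto intro!: derivative_eq_intros)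
  qed
qed

lemma real_has_zero_derivative_constant:
  fixes f :: "real \<Rightarrow> real"
  assumes "\<And>x. (f has_real_derivative 0) (at x)"
  shows "f x = f y"
  using DERIV_isconst_all assms by blast

text \<open>
  A curve on the unit circle with a given angular velocity \<open>G\<close> lifts to an angle: any antiderivative
  \<open>B\<close> of \<open>G\<close> works, because the point \<open>(cos B, sin B)\<close> and the curve rotate at the same rate, so
  their scalar and cross products stay at their initial values \<open>1\<close> and \<open>0\<close>.
\<close>
lemma phase_angle_exists:
  fixes P Q G :: "real \<Rightarrow> real"
  assumes P: "\<And>t. (P has_real_derivative Q t * G t) (at t)"
    and Q: "\<And>t. (Q has_real_derivative - P t * G t) (at t)"
    and G: "continuous_on UNIV G"
    and init: "P 0 = sin a" "Q 0 = cos a"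
  obtains B where "B 0 = a" and "\<And>t. (B has_real_derivative G t) (at t)"
    and "\<And>t. sin (B t) = P t" and "\<And>t. cos (B t) = Q t"
proof -
  obtain B where B0: "B 0 = a" and B: "\<And>t. (B has_real_derivative G t) (at t)"
    using antiderivative_on_reals[OF G] by metis
  have "((\<lambda>t. P t * cos (B t) - Q t * sin (B t)) has_real_derivative 0) (at t)" for t
    by (rule derivative_eq_intros P Q B refl | simp add: algebra_simps)+
  then have sin_diff: "P t * cos (B t) - Q t * sin (B t) = 0" for t
    using real_has_zero_derivative_constant[of "\<lambda>t. P t * cos (B t) - Q t * sin (B t)" t 0] B0 init
    by simp
  have "((\<lambda>t. P t * sin (B t) + Q t * cos (B t)) has_real_derivative 0) (at t)" for t
    by (rule derivative_eq_intros P Q B refl | simp add: algebra_simps)+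
  then have cos_diff: "P t * sin (B t) + Q t * cos (B t) = 1" for t
    using real_has_zero_derivative_constant[of "\<lambda>t. P t * sin (B t) + Q t * cos (B t)" t 0] B0 init
    by (simp flip: power2_eq_square)
  show thesis
  proof
    fix t
    have "sin (B t) ^ 2 + cos (B t) ^ 2 = 1" by simp
    with sin_diff[of t] cos_diff[of t] show "sin (B t) = P t" "cos (B t) = Q t"
      by algebra+
  qed (use B0 B in auto)
qed

section \<open>Elliptic integrals of the first kind and the Jacobi amplitude\<close>

lemma elliptic_integrand_pos:
  fixes m :: real
  assumes "0 \<le> m" "m < 1"
  shows "0 < 1 - m * (sin x)\<^sup>2"
proof -
  have "m * (sin x)\<^sup>2 \<le> m * 1"
    using assms by (intro mult_left_mono) (auto simp: abs_square_le_1)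
  then show ?thesis using assms by linarith
qed

text \<open>
  \<open>F\<close> is Legendre's incomplete integral with parameter \<open>m\<close>, normalised by \<open>F 0 = 0\<close>. The integrand is
  even and has period \<open>\<pi>\<close>; hence \<open>F\<close> is odd and \<open>F (x + \<pi>) - F x\<close> is a constant, which is read off at
  \<open>x = - \<pi>/2\<close>. This gives the values of \<open>F\<close> at all multiples of \<open>\<pi>/2\<close>.
\<close>
lemma elliptic_F_exists:
  assumes m: "0 \<le> m" "m < 1"
  obtains F where "\<And>x. (F has_real_derivative 1 / sqrt (1 - m * (sin x)\<^sup>2)) (at x)"
    and "strict_mono F" and "\<And>n::int. F (n * pi / 2) = n * elliptic_K m"
proof -
  let ?f = "\<lambda>x. 1 / sqrt (1 - m * (sin x)\<^sup>2)"
  note pos = elliptic_integrand_pos[OF m]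
  have "continuous_on UNIV ?f"
    using pos by (intro continuous_intros) (simp add: less_imp_neq[symmetric])
  then obtain F where F0: "F 0 = 0" and F: "\<And>x. (F has_real_derivative ?f x) (at x)"
    using antiderivative_on_reals[of ?f 0 0] by blast
  have odd: "F (- x) = - F x" for x
  proof -
    have "((\<lambda>x. F (- x) + F x) has_real_derivative 0) (at x)" for x
      by (rule derivative_eq_intros F DERIV_chain2[OF F] refl | simp)+
    from real_has_zero_derivative_constant[OF this, of x 0] F0 show ?thesis by simp
  qed
  have quarter: "F (pi / 2) = elliptic_K m"
  proof -
    have "(?f has_integral F (pi / 2) - F 0) {0..pi / 2}"
      using F by (intro fundamental_theorem_of_calculus)
        (auto simp: has_real_derivative_iff_has_vector_derivative[symmetric]
              intro: has_field_derivative_at_within)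
    then show ?thesis
      unfolding elliptic_K_def using F0 by (simp add: integral_unique)
  qed
  have shift: "F (x + pi) = F x + 2 * elliptic_K m" for x
  proof -
    have "((\<lambda>x. F (x + pi) - F x) has_real_derivative 0) (at x)" for x
      by (rule derivative_eq_intros F DERIV_chain2[OF F] refl | simp)+
    from real_has_zero_derivative_constant[OF this, of x "- (pi / 2)"]
    show ?thesis using odd[of "pi / 2"] quarter by (simp add: field_simps)
  qed
  have nat_mult: "F (n * pi / 2) = n * elliptic_K m" for n :: nat
  proof (induction n rule: nat_induct2)
    case (step n)
    have "real (n + 2) * pi / 2 = n * pi / 2 + pi" by (simp add: field_simps)
    then show ?case using shift[of "n * pi / 2"] step by (simp add: field_simps)
  qed (use F0 quarter in auto)
  have "strict_mono F"
  proof (rule strict_monoI)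
    fix x y :: real assume "x < y"
    moreover have "0 < ?f z" for z using pos[of z] by simp
    ultimately show "F x < F y"
      using F by (meson DERIV_pos_imp_increasing)
  qed
  show thesis
  proof
    show "F (n * pi / 2) = n * elliptic_K m" for n :: int
      using nat_mult[of "nat n"] nat_mult[of "nat (- n)"] odd[of "n * pi / 2"]
      by (cases "n \<ge> 0") auto
  qed (fact F \<open>strict_mono F\<close>)+
qed

lemma elliptic_K_pos:
  assumes "0 \<le> m" "m < 1"
  shows "0 < elliptic_K m"
proof -
  obtain F where "strict_mono F" and K: "\<And>n::int. F (n * pi / 2) = n * elliptic_K m"
    using elliptic_F_exists[OF assms] by metis
  then have "F 0 < F (pi / 2)" by (simp add: strict_mono_less)
  then show ?thesis using K[of 0] K[of 1] by simp
qed

text \<open>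
  Separation of variables: \<open>F (B t) - \<omega> t\<close> has derivative zero, so \<open>F (B t) = \<omega> t - K(m)\<close>, where the
  constant comes from \<open>B 0 = - \<pi>/2\<close>. Since \<open>F\<close> is injective, this determines both whether and when \<open>B\<close>
  takes a given value.
\<close>
lemma amplitude_at_quarter_turn_iff:
  fixes n :: int
  assumes m: "0 \<le> m" "m < 1" and \<omega>: "\<omega> > 0" and B0: "B 0 = - (pi / 2)"
    and B: "\<And>t. (B has_real_derivative \<omega> * sqrt (1 - m * (sin (B t))\<^sup>2)) (at t)"
  shows "B t = n * pi / 2 \<longleftrightarrow> t = (n + 1) * (elliptic_K m / \<omega>)"
proof -
  obtain F where F: "\<And>x. (F has_real_derivative 1 / sqrt (1 - m * (sin x)\<^sup>2)) (at x)"
    and "strict_mono F" and K: "\<And>n::int. F (n * pi / 2) = n * elliptic_K m"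
    using elliptic_F_exists[OF m] by blast
  note pos = elliptic_integrand_pos[OF m]
  have "((\<lambda>t. F (B t) - \<omega> * t) has_real_derivative 0) (at t)" for t
    using pos[of "B t"]
    by (auto intro!: derivative_eq_intros B DERIV_chain2[OF F])
  from real_has_zero_derivative_constant[OF this, of _ 0]
  have time: "F (B t) = \<omega> * t - elliptic_K m" for t
    using K[of "-1"] B0 by (simp add: field_simps)
  have "B t = n * pi / 2 \<longleftrightarrow> F (B t) = F (n * pi / 2)"
    using \<open>strict_mono F\<close> by (simp add: strict_mono_eq)
  also have "\<dots> \<longleftrightarrow> \<omega> * t = (n + 1) * elliptic_K m"
    unfolding K time by (simp add: algebra_simps)
  also have "\<dots> \<longleftrightarrow> t = (n + 1) * (elliptic_K m / \<omega>)"
    using \<omega> by (auto simp: field_simps)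
  finally show ?thesis .
qed

section \<open>The motion of the angular momentum vector\<close>

text \<open>
  The singular terms with \<open>tan \<theta>\<close> come from the spherical coordinates only: in \<open>X'\<close> and \<open>Y'\<close> the
  tangent occurs multiplied by \<open>cos \<theta>\<close>.
\<close>
lemma rotor_on_motion_cartesian:
  assumes "rotor_on_motion \<gamma> \<rho> \<phi> \<theta> \<psi>"
  defines "X \<equiv> \<lambda>\<tau>. cos (\<theta> \<tau>) * cos (\<psi> \<tau>)" and "Y \<equiv> \<lambda>\<tau>. - cos (\<theta> \<tau>) * sin (\<psi> \<tau>)"
    and "Z \<equiv> \<lambda>\<tau>. sin (\<theta> \<tau>)"
  shows "(X has_real_derivative Z \<tau> * (\<rho> + \<gamma> * Y \<tau>)) (at \<tau>)"
    and "(Y has_real_derivative - \<gamma> * X \<tau> * Z \<tau>) (at \<tau>)"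
    and "(Z has_real_derivative - \<rho> * X \<tau>) (at \<tau>)"
proof -
  have \<theta>: "(\<theta> has_real_derivative - \<rho> * cos (\<psi> \<tau>)) (at \<tau>)"
    and \<psi>: "(\<psi> has_real_derivative \<gamma> * sin (\<theta> \<tau>) - \<rho> * tan (\<theta> \<tau>) * sin (\<psi> \<tau>)) (at \<tau>)"
    and "cos (\<theta> \<tau>) > 0"
    using assms(1) by (auto simp: rotor_on_motion_def intro: cos_gt_zero_pi)
  then have tan: "cos (\<theta> \<tau>) * tan (\<theta> \<tau>) = sin (\<theta> \<tau>)" by (simp add: tan_def)
  \<comment> \<open>The chain rule's value of \<open>X'\<close>, with \<open>w\<close> for the tangent; \<open>v\<close> and \<open>b\<close> are sine and cosine of
      the twist, whose squares add up to \<open>1\<close>.\<close>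
  have X_rhs: "- u * (- a * b) * b + - v * (g * u - a * w * v) * d = a * u * (v\<^sup>2 + b\<^sup>2) - g * u * d * v"
    if "d * w = u" for a b d g u v w :: real
    unfolding that[symmetric] by (simp add: algebra_simps power2_eq_square)
  show "(X has_real_derivative Z \<tau> * (\<rho> + \<gamma> * Y \<tau>)) (at \<tau>)"
    unfolding X_def Y_def Z_def
    by (rule derivative_eq_intros \<theta> \<psi> refl)+ (simp only: X_rhs[OF tan], simp add: algebra_simps)
  show "(Y has_real_derivative - \<gamma> * X \<tau> * Z \<tau>) (at \<tau>)"
    unfolding X_def Y_def Z_def
    by (rule derivative_eq_intros \<theta> \<psi> refl)+
      (use \<open>cos (\<theta> \<tau>) > 0\<close> in \<open>simp add: tan_def field_simps\<close>)
  show "(Z has_real_derivative - \<rho> * X \<tau>) (at \<tau>)"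
    unfolding X_def Z_def
    by (rule derivative_eq_intros \<theta> refl)+ algebra
qed

text \<open>
  The two conservation laws confine \<open>(Z, X)\<close> to the oval \<open>s\<^sup>4 X\<^sup>2 = (s\<^sup>2 - Z\<^sup>2) R\<^sup>2\<close> with
  \<open>R\<^sup>2 = s\<^sup>2 + c\<^sup>2 Z\<^sup>2\<close>. Dividing by \<open>s\<^sup>2 R\<^sup>2\<close> shows that \<open>(s X / R, Z / s)\<close> lies on the unit circle, where it moves with
  angular speed \<open>\<bar>\<rho>\<bar> R / s\<^sup>2\<close>. The angle \<open>B\<close> starts at \<open>- \<pi>/2\<close> rather than \<open>0\<close>, and the
  cosine is assigned to \<open>Z\<close>, so that \<open>R\<^sup>2\<close> is proportional to \<open>1 - k\<^sup>2 sin\<^sup>2 B\<close>, the Legendre form.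
  The factor \<open>- sgn \<rho>\<close> makes \<open>B\<close> increase for either sign of \<open>\<rho>\<close>. The condition
  \<open>\<gamma> s\<^sup>2 = 2 c \<rho>\<close> is \<open>s\<^sup>2 = 2 \<beta> c\<close> without the quotient.
\<close>
lemma cartesian_orbit_phase:
  fixes X Y Z :: "real \<Rightarrow> real"
  assumes X: "\<And>\<tau>. (X has_real_derivative Z \<tau> * (\<rho> + \<gamma> * Y \<tau>)) (at \<tau>)"
    and Y: "\<And>\<tau>. (Y has_real_derivative - \<gamma> * X \<tau> * Z \<tau>) (at \<tau>)"
    and Z: "\<And>\<tau>. (Z has_real_derivative - \<rho> * X \<tau>) (at \<tau>)"
    and init: "X 0 = 1" "Y 0 = 0" "Z 0 = 0"
    and \<rho>: "\<rho> \<noteq> 0" and s: "s > 0" and c: "c > 0" and cs: "c\<^sup>2 + s\<^sup>2 = 1"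
    and \<gamma>: "\<gamma> * s\<^sup>2 = 2 * c * \<rho>"
    and k: "k > 0" "k\<^sup>2 = c\<^sup>2 / (1 + c\<^sup>2)"
  obtains B where "B 0 = - (pi / 2)"
    and "\<And>\<tau>. (B has_real_derivative \<bar>\<gamma>\<bar> * s / (2 * k) * sqrt (1 - k\<^sup>2 * (sin (B \<tau>))\<^sup>2)) (at \<tau>)"
    and "\<And>\<tau>. Z \<tau> = - sgn \<rho> * s * cos (B \<tau>)"
    and "\<And>\<tau>. Y \<tau> = c * (cos (B \<tau>))\<^sup>2"
    and "\<And>\<tau>. X \<tau> = 0 \<longleftrightarrow> sin (B \<tau>) = 0"
proof -
  have \<gamma>': "\<gamma> = 2 * c * \<rho> / s\<^sup>2" using \<gamma> s by (simp add: field_simps)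
  have "((\<lambda>\<tau>. 2 * \<rho> * Y \<tau> - \<gamma> * (Z \<tau>)\<^sup>2) has_real_derivative 0) (at \<tau>)" for \<tau>
    by (rule derivative_eq_intros Y Z refl | simp)+
  from real_has_zero_derivative_constant[OF this, of _ 0] init
  have "2 * \<rho> * Y \<tau> = \<gamma> * (Z \<tau>)\<^sup>2" for \<tau> by simp
  then have Yeq: "Y \<tau> = c * (Z \<tau>)\<^sup>2 / s\<^sup>2" for \<tau>
    using \<rho> s unfolding \<gamma>' by (simp add: field_simps)
  have "((\<lambda>\<tau>. (X \<tau>)\<^sup>2 + (Y \<tau>)\<^sup>2 + (Z \<tau>)\<^sup>2) has_real_derivative 0) (at \<tau>)" for \<tau>
    by (rule derivative_eq_intros X Y Z refl | simp add: algebra_simps)+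
  from real_has_zero_derivative_constant[OF this, of _ 0] init
  have sphere: "(X \<tau>)\<^sup>2 + (Y \<tau>)\<^sup>2 + (Z \<tau>)\<^sup>2 = 1" for \<tau> by simp
  define R where "R \<tau> = sqrt (s\<^sup>2 + c\<^sup>2 * (Z \<tau>)\<^sup>2)" for \<tau>
  have rad: "s\<^sup>2 + c\<^sup>2 * (Z \<tau>)\<^sup>2 > 0" for \<tau>
    using s by (simp add: add_pos_nonneg)
  have Rpos: "R \<tau> > 0" for \<tau> using rad by (simp add: R_def)
  have R2: "(R \<tau>)\<^sup>2 = s\<^sup>2 + c\<^sup>2 * (Z \<tau>)\<^sup>2" for \<tau> using rad[of \<tau>] by (simp add: R_def)
  have X2: "(X \<tau>)\<^sup>2 * s ^ 4 = (s\<^sup>2 - (Z \<tau>)\<^sup>2) * (R \<tau>)\<^sup>2" for \<tau>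
  proof -
    have "Y \<tau> * s\<^sup>2 = c * (Z \<tau>)\<^sup>2" using s by (simp add: Yeq)
    then show ?thesis using sphere[of \<tau>] R2[of \<tau>] cs by algebra
  qed
  have R': "(R has_real_derivative - \<rho> * c\<^sup>2 * Z \<tau> * X \<tau> / R \<tau>) (at \<tau>)" for \<tau>
    unfolding R_def using rad[of \<tau>]
    by (auto intro!: derivative_eq_intros Z simp: field_simps)
  define P where "P \<tau> = - s * X \<tau> / R \<tau>" for \<tau>
  define Q where "Q \<tau> = - sgn \<rho> * Z \<tau> / s" for \<tau>
  define G where "G \<tau> = \<bar>\<rho>\<bar> * R \<tau> / s\<^sup>2" for \<tau>
  have sg: "\<rho> = sgn \<rho> * \<bar>\<rho>\<bar>" "sgn \<rho> * sgn \<rho> = 1" using \<rho> by (auto simp: sgn_if)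
  have P': "(P has_real_derivative Q \<tau> * G \<tau>) (at \<tau>)" for \<tau>
  proof -
    have "(P has_real_derivative
        ((- s * (Z \<tau> * (\<rho> + \<gamma> * Y \<tau>))) * R \<tau> - (- s * X \<tau>) * (- \<rho> * c\<^sup>2 * Z \<tau> * X \<tau> / R \<tau>)) / (R \<tau> * R \<tau>)) (at \<tau>)"
      unfolding P_def
      by (rule DERIV_divide DERIV_cmult X R')+ (use Rpos[of \<tau>] in simp)
    moreover have "((- s * (Z \<tau> * (\<rho> + \<gamma> * Y \<tau>))) * R \<tau> - (- s * X \<tau>) * (- \<rho> * c\<^sup>2 * Z \<tau> * X \<tau> / R \<tau>)) / (R \<tau> * R \<tau>)
        = Q \<tau> * G \<tau>"
    proof -
      \<comment> \<open>\<open>N\<close> is the numerator, with \<open>X\<^sup>2 / R\<close> kept together: by the equation of the oval it is a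
          polynomial in \<open>Z\<close> and \<open>R\<close>.\<close>
      define N where "N = - s * (Z \<tau> * (\<rho> + \<gamma> * Y \<tau>)) * R \<tau> - s * \<rho> * c\<^sup>2 * Z \<tau> * ((X \<tau>)\<^sup>2 / R \<tau>)"
      have "(X \<tau>)\<^sup>2 / R \<tau> * s ^ 4 = (s\<^sup>2 - (Z \<tau>)\<^sup>2) * R \<tau>"
        using X2[of \<tau>] Rpos[of \<tau>] by (simp add: field_simps power2_eq_square)
      moreover have "\<gamma> * Y \<tau> * s ^ 4 = 2 * c\<^sup>2 * \<rho> * (Z \<tau>)\<^sup>2"
        using s by (simp add: Yeq \<gamma>' field_simps power2_eq_square power4_eq_xxxx)
      ultimately have "N * s ^ 4 = - s * \<rho> * Z \<tau> * R \<tau> * (R \<tau>)\<^sup>2"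
        unfolding N_def using R2[of \<tau>] cs by algebra
      then have "s * (N * s ^ 3) = s * (- \<rho> * Z \<tau> * R \<tau> * (R \<tau>)\<^sup>2)"
        by algebra
      then have "N * s ^ 3 = - \<rho> * Z \<tau> * R \<tau> * (R \<tau>)\<^sup>2"
        unfolding mult_left_cancel[OF less_imp_neq[OF s, symmetric]] .
      then have "N / (R \<tau> * R \<tau>) = - \<rho> * Z \<tau> * R \<tau> / s ^ 3"
        using s Rpos[of \<tau>] by (simp add: field_simps power3_eq_cube power2_eq_square power4_eq_xxxx)
      also have "\<dots> = Q \<tau> * G \<tau>"
        using sg s by (simp add: Q_def G_def field_simps power3_eq_cube power2_eq_square)
      finally show ?thesis by (simp add: N_def power2_eq_square algebra_simps)
    qed
    ultimately show ?thesis by simp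
  qed
  have Q': "(Q has_real_derivative - P \<tau> * G \<tau>) (at \<tau>)" for \<tau>
  proof -
    have "(Q has_real_derivative - sgn \<rho> * (- \<rho> * X \<tau>) / s) (at \<tau>)"
      unfolding Q_def using s by (auto intro!: derivative_eq_intros Z)
    moreover have "- sgn \<rho> * (- \<rho> * X \<tau>) / s = - P \<tau> * G \<tau>"
      using sg s Rpos[of \<tau>] by (simp add: P_def G_def field_simps power2_eq_square abs_sgn)
    ultimately show ?thesis by simp
  qed
  have "continuous_on UNIV R"
    using R' by (meson DERIV_isCont continuous_at_imp_continuous_on)
  then have G: "continuous_on UNIV G" unfolding G_def by (intro continuous_intros) (use s in auto)
  have "P 0 = sin (- (pi / 2))" "Q 0 = cos (- (pi / 2))"
    using init s by (auto simp: P_def Q_def R_def)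
  from phase_angle_exists[OF P' Q' G this] obtain B where B0: "B 0 = - (pi / 2)"
    and B: "\<And>\<tau>. (B has_real_derivative G \<tau>) (at \<tau>)"
    and sinB: "\<And>\<tau>. sin (B \<tau>) = P \<tau>" and cosB: "\<And>\<tau>. cos (B \<tau>) = Q \<tau>" by metis
  have Zeq: "Z \<tau> = - sgn \<rho> * s * cos (B \<tau>)" for \<tau>
    using sg s by (simp add: cosB Q_def)
  have Z2: "(Z \<tau>)\<^sup>2 = s\<^sup>2 * (cos (B \<tau>))\<^sup>2" for \<tau>
    using sg(2) by (simp add: Zeq power_mult_distrib power2_eq_square)
  have speed: "G \<tau> = \<bar>\<gamma>\<bar> * s / (2 * k) * sqrt (1 - k\<^sup>2 * (sin (B \<tau>))\<^sup>2)" for \<tau>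
  proof -
    \<comment> \<open>The factor \<open>d\<^sup>2 = 1 + c\<^sup>2\<close> taken out of \<open>R\<^sup>2 / s\<^sup>2\<close> leaves \<open>1 - k\<^sup>2 sin\<^sup>2 B\<close>.\<close>
    define d where "d = c / k"
    have d: "d > 0" "c = d * k" using c k(1) by (simp_all add: d_def)
    have "d\<^sup>2 = 1 + c\<^sup>2"
      using k(2) c zero_le_power2[of c] by (simp add: d_def power_divide)
    moreover have "(R \<tau>)\<^sup>2 = s\<^sup>2 * (1 + c\<^sup>2 - c\<^sup>2 * (sin (B \<tau>))\<^sup>2)"
      unfolding R2 Z2 cos_squared_eq by (simp add: algebra_simps)
    ultimately have "(R \<tau>)\<^sup>2 = (s * d)\<^sup>2 * (1 - k\<^sup>2 * (sin (B \<tau>))\<^sup>2)"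
      using d(2) by algebra
    then have "sqrt ((s * d)\<^sup>2 * (1 - k\<^sup>2 * (sin (B \<tau>))\<^sup>2)) = R \<tau>"
      using Rpos[of \<tau>] by (intro real_sqrt_unique) simp_all
    then have "R \<tau> = s * d * sqrt (1 - k\<^sup>2 * (sin (B \<tau>))\<^sup>2)"
      using s d(1) by (simp add: real_sqrt_mult)
    moreover have "\<bar>\<rho>\<bar> / s\<^sup>2 * (s * d) = \<bar>\<gamma>\<bar> * s / (2 * k)"
      using s c k(1) by (simp add: \<gamma>' d_def abs_mult field_simps power2_eq_square)
    ultimately show ?thesis
      unfolding G_def by (metis (no_types, opaque_lifting) mult.assoc times_divide_eq_left)
  qed
  show thesis
  proof
    show "B 0 = - (pi / 2)" by (fact B0)
    show "(B has_real_derivative \<bar>\<gamma>\<bar> * s / (2 * k) * sqrt (1 - k\<^sup>2 * (sin (B \<tau>))\<^sup>2)) (at \<tau>)" for \<tau>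
      using B[of \<tau>] by (simp add: speed)
    show "Z \<tau> = - sgn \<rho> * s * cos (B \<tau>)" for \<tau> by (fact Zeq)
    show "Y \<tau> = c * (cos (B \<tau>))\<^sup>2" for \<tau> using s by (simp add: Yeq Z2)
    show "X \<tau> = 0 \<longleftrightarrow> sin (B \<tau>) = 0" for \<tau>
      using s Rpos[of \<tau>] by (simp add: sinB P_def)
  qed
qed

section \<open>Maximal tilt and transit time\<close>

lemma vector_3_eq_iff:
  "(vector [x1, x2, x3] :: 'a::zero ^ 3) = vector [y1, y2, y3] \<longleftrightarrow> x1 = y1 \<and> x2 = y2 \<and> x3 = y3"
  by (auto simp: vec_eq_iff forall_3 vector_3)

lemma scaleR_vector_3:
  "r *\<^sub>R (vector [x1, x2, x3] :: real ^ 3) = vector [r * x1, r * x2, r * x3]"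
  by (simp add: vec_eq_iff forall_3 vector_3)

lemma turning_cosine:
  fixes \<beta> :: real
  assumes \<beta>: "\<beta> > 0"
  defines "c \<equiv> sqrt (\<beta>\<^sup>2 + 1) - \<beta>"
  shows "0 < c" and "c < 1" and "c\<^sup>2 + 2 * \<beta> * c = 1"
proof -
  have sq: "(c + \<beta>)\<^sup>2 = \<beta>\<^sup>2 + 1"
    by (simp add: c_def)
  then show "c\<^sup>2 + 2 * \<beta> * c = 1"
    by (simp add: power2_eq_square algebra_simps)
  have "sqrt (\<beta>\<^sup>2) < sqrt (\<beta>\<^sup>2 + 1)" by (subst real_sqrt_less_iff) simp
  then show "0 < c" using \<beta> by (simp add: c_def)
  have "sqrt (\<beta>\<^sup>2 + 1) < \<beta> + 1"
    using \<beta> by (intro real_less_lsqrt) (auto simp: power2_eq_square algebra_simps)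
  then show "c < 1" by (simp add: c_def)
qed

theorem lemma4:
  fixes I1 I2 I3 l h \<gamma> \<rho> \<beta> :: real
    and \<phi> \<theta> \<psi> :: "real \<Rightarrow> real"
    and L :: "real \<Rightarrow> real^3"
  assumes "I1 > 0" and "I2 > 0" and "I3 > 0" and "I1 = I2" and "l > 0"
    and "\<gamma> = I1 / I3 - 1" and "\<rho> = h / l"
    and "\<beta> = \<rho> / \<gamma>" and "\<beta> > 0"
    and "rotor_on_motion \<gamma> \<rho> \<phi> \<theta> \<psi>"
    and "\<And>t. L t = ang_mom l (\<theta> (t * l / I1)) (\<psi> (t * l / I1))"
    and "L 0 = vector [l, 0, 0]"
  shows "\<exists>\<theta>max s k T2.
           \<theta>max \<in> \<theta> ` {0..} \<and> (\<forall>\<tau>\<ge>0. \<theta> \<tau> \<le> \<theta>max) \<and>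
           cos \<theta>max = sqrt (\<beta>\<^sup>2 + 1) - \<beta> \<and>
           s = sin \<theta>max \<and> s > 0 \<and>
           \<beta> = s\<^sup>2 / (2 * sqrt (1 - s\<^sup>2)) \<and>
           k > 0 \<and> k\<^sup>2 = (1 - s\<^sup>2) / (2 - s\<^sup>2) \<and>
           is_transit_time L (vector [l, 0, 0]) (l *\<^sub>R vector [0, cos \<theta>max, sin \<theta>max]) T2 \<and>
           is_first_arrival_time L (l *\<^sub>R vector [0, cos \<theta>max, - sgn \<rho> * sin \<theta>max]) T2 \<and>
           l / I1 * T2 = 2 * k / (s * \<bar>\<gamma>\<bar>) * elliptic_K (k\<^sup>2)"
proof -
  define c where "c = sqrt (\<beta>\<^sup>2 + 1) - \<beta>"
  note c = turning_cosine[OF \<open>\<beta> > 0\<close>, folded c_def]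
  define \<theta>max where "\<theta>max = arccos c"
  define s where "s = sin \<theta>max"
  define k where "k = sqrt ((1 - s\<^sup>2) / (2 - s\<^sup>2))"
  define \<omega> where "\<omega> = \<bar>\<gamma>\<bar> * s / (2 * k)"
  define T where "T = elliptic_K (k\<^sup>2) / \<omega>"
  define T2 where "T2 = T * (I1 / l)"
  have cos_max: "cos \<theta>max = c" using c by (simp add: \<theta>max_def)
  have max_range: "0 < \<theta>max" "\<theta>max \<le> pi / 2"
    using c arccos_lt_bounded[of c] arccos_le_pi2[of c] by (auto simp: \<theta>max_def)
  then have s_pos: "s > 0" unfolding s_def by (intro sin_gt_zero) auto
  have cs: "c\<^sup>2 + s\<^sup>2 = 1" by (simp add: s_def flip: cos_max)
  have s2: "s\<^sup>2 = 2 * \<beta> * c" and c2: "1 - s\<^sup>2 = c\<^sup>2" using cs c(3) by linarith+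
  have "\<gamma> \<noteq> 0" "\<rho> \<noteq> 0" and \<rho>: "\<rho> = \<beta> * \<gamma>"
    using \<open>\<beta> = \<rho> / \<gamma>\<close> \<open>\<beta> > 0\<close> by auto
  have inverse: "\<beta> = s\<^sup>2 / (2 * sqrt (1 - s\<^sup>2))" using c(1) by (simp add: c2) (simp add: s2)
  have k2: "k\<^sup>2 = (1 - s\<^sup>2) / (2 - s\<^sup>2)" and k_c: "k\<^sup>2 = c\<^sup>2 / (1 + c\<^sup>2)"
  proof -
    have "s\<^sup>2 = 1 - c\<^sup>2" using c2 by simp
    then show "k\<^sup>2 = (1 - s\<^sup>2) / (2 - s\<^sup>2)" "k\<^sup>2 = c\<^sup>2 / (1 + c\<^sup>2)"
      by (simp_all add: k_def)
  qed
  have k_pos: "k > 0" and k_less: "k\<^sup>2 < 1"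
  proof -
    have "0 < c\<^sup>2 / (1 + c\<^sup>2)" "c\<^sup>2 / (1 + c\<^sup>2) < 1"
      using c(1) by (auto simp: add_pos_pos field_simps)
    then show "k > 0" "k\<^sup>2 < 1" using k2 k_c by (auto simp: k_def)
  qed
  have \<omega>: "\<omega> > 0" using \<open>\<gamma> \<noteq> 0\<close> s_pos k_pos by (simp add: \<omega>_def)
  have T_pos: "T > 0" using elliptic_K_pos[of "k\<^sup>2"] k_less \<omega> by (simp add: T_def)
  have T2_pos: "T2 > 0" using T_pos assms by (simp add: T2_def)

  define X where "X = (\<lambda>\<tau>. cos (\<theta> \<tau>) * cos (\<psi> \<tau>))"
  define Y where "Y = (\<lambda>\<tau>. - cos (\<theta> \<tau>) * sin (\<psi> \<tau>))"
  define Z where "Z = (\<lambda>\<tau>. sin (\<theta> \<tau>))"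
  have L_iff: "L t = vector [l * x, l * y, l * z] \<longleftrightarrow>
      X (t * l / I1) = x \<and> Y (t * l / I1) = y \<and> Z (t * l / I1) = z" for t x y z
  proof -
    have "L t = vector [l * X (t * l / I1), l * Y (t * l / I1), l * Z (t * l / I1)]"
      by (simp add: assms(11) ang_mom_def X_def Y_def Z_def)
    then show ?thesis using \<open>l > 0\<close> by (simp add: vector_3_eq_iff)
  qed
  have start: "vector [l, 0, 0] = (vector [l * 1, l * 0, l * 0] :: real ^ 3)" by simp
  have init: "X 0 = 1" "Y 0 = 0" "Z 0 = 0"
    using \<open>L 0 = vector [l, 0, 0]\<close> unfolding start L_iff by auto

  obtain B where B0: "B 0 = - (pi / 2)"
    and B: "\<And>\<tau>. (B has_real_derivative \<omega> * sqrt (1 - k\<^sup>2 * (sin (B \<tau>))\<^sup>2)) (at \<tau>)"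
    and Z: "\<And>\<tau>. Z \<tau> = - sgn \<rho> * s * cos (B \<tau>)"
    and Y: "\<And>\<tau>. Y \<tau> = c * (cos (B \<tau>))\<^sup>2"
    and X: "\<And>\<tau>. X \<tau> = 0 \<longleftrightarrow> sin (B \<tau>) = 0"
  proof (rule cartesian_orbit_phase[of X Z \<rho> \<gamma> Y s c k])
    show "\<gamma> * s\<^sup>2 = 2 * c * \<rho>" by (simp add: s2 \<rho>)
  qed (use rotor_on_motion_cartesian[OF assms(10)] init \<open>\<rho> \<noteq> 0\<close> s_pos c(1) cs k_pos k_c
       in \<open>simp_all add: X_def Y_def Z_def \<omega>_def\<close>)
  have turn: "B \<tau> = n * pi / 2 \<longleftrightarrow> \<tau> = (n + 1) * T" for \<tau> and n :: int
    unfolding T_def by (rule amplitude_at_quarter_turn_iff[OF _ k_less \<omega> B0 B]) simp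
  \<comment> \<open>Passage from dimensionless time, in quarter periods \<open>T\<close>, to physical time.\<close>
  have scaled: "t * l / I1 = r * T \<longleftrightarrow> t = r * T2" for t r
    using assms(1,5) by (auto simp: T2_def field_simps)

  have at_start: "\<exists>n::int. even n \<and> t = n * T2" if "L t = vector [l, 0, 0]" for t
  proof -
    have "cos (B (t * l / I1)) = 0"
      using that s_pos \<open>\<rho> \<noteq> 0\<close> unfolding start L_iff Z by (auto simp: sgn_zero_iff)
    then obtain n :: int where "odd n" "B (t * l / I1) = n * pi / 2"
      by (auto simp: cos_zero_iff_int)
    then have "even (n + 1)" "t = of_int (n + 1) * T2"
      using turn scaled by auto
    then show ?thesis by blast
  qed
  have at_turn: "\<exists>n::int. odd n \<and> t = n * T2" if "L t = vector [l * 0, l * y, l * z]" for t y z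
  proof -
    have "sin (B (t * l / I1)) = 0"
      using that unfolding L_iff X by auto
    then obtain n :: int where "even n" "B (t * l / I1) = n * pi / 2"
      by (auto simp: sin_zero_iff_int)
    then have "odd (n + 1)" "t = of_int (n + 1) * T2"
      using turn scaled by auto
    then show ?thesis by blast
  qed

  \<comment> \<open>The turning points nearest to the start: \<open>Z\<close> is \<open>- sgn \<rho> * s\<close> at time \<open>T\<close> and \<open>sgn \<rho> * s\<close> at times
      \<open>- T\<close> and \<open>3 * T\<close>.\<close>
  have B_at: "B T = 0" "B (- T) = - pi" "B (3 * T) = pi"
    using turn[of T 0] turn[of "- T" "-2"] turn[of "3 * T" 2] by auto
  have L_at: "L t = vector [l * 0, l * c, l * z]"
    if "t = r * T2" "sin (B (r * T)) = 0" "Z (r * T) = z" for t r z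
  proof -
    have "(cos (B (r * T)))\<^sup>2 = 1" using that(2) by (simp add: cos_squared_eq)
    then show ?thesis using that unfolding L_iff scaled[THEN iffD2, OF that(1)] X Y by simp
  qed

  have Z_le: "Z \<tau> \<le> s" for \<tau>
  proof -
    have "\<bar>Z \<tau>\<bar> \<le> s * 1"
      unfolding Z abs_mult using s_pos by (intro mult_mono) (auto simp: sgn_if)
    then show ?thesis by simp
  qed
  have \<theta>_range: "- (pi / 2) < \<theta> \<tau>" "\<theta> \<tau> < pi / 2" for \<tau>
    using assms(10) by (auto simp: rotor_on_motion_def)
  have bound: "\<theta> \<tau> \<le> \<theta>max" for \<tau>
    using Z_le[of \<tau>] sin_mono_le_eq[of "\<theta> \<tau>" \<theta>max] \<theta>_range[of \<tau>] max_range
    by (simp add: Z_def s_def)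
  have attained: "\<theta>max \<in> \<theta> ` {0..}"
  proof -
    \<comment> \<open>For \<open>\<rho> > 0\<close> the tilt decreases at first, so the maximum is reached only after three quarters of
        a period.\<close>
    define \<tau> where "\<tau> = (if \<rho> > 0 then 3 * T else T)"
    have "Z \<tau> = s" using \<open>\<rho> \<noteq> 0\<close> B_at by (auto simp: Z \<tau>_def sgn_if)
    then have "\<theta>max \<le> \<theta> \<tau>"
      using sin_mono_le_eq[of \<theta>max "\<theta> \<tau>"] \<theta>_range[of \<tau>] max_range by (simp add: Z_def s_def)
    then have "\<theta> \<tau> = \<theta>max" using bound[of \<tau>] by simp
    moreover have "\<tau> \<ge> 0" using T_pos by (simp add: \<tau>_def)
    ultimately show ?thesis by (metis atLeast_iff imageI)
  qed

  have end_point: "l *\<^sub>R vector [0, cos \<theta>max, z] = (vector [l * 0, l * c, l * z] :: real ^ 3)" for z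
    by (simp add: scaleR_vector_3 cos_max)
  have transit: "is_transit_time L (vector [l, 0, 0]) (l *\<^sub>R vector [0, cos \<theta>max, sin \<theta>max]) T2"
    unfolding is_transit_time_def end_point s_def[symmetric]
  proof (intro conjI allI impI)
    \<comment> \<open>For \<open>\<rho> > 0\<close> the end point with positive tilt is the one passed a quarter period before the start.\<close>
    have "L (- sgn \<rho> * T2) = vector [l * 0, l * c, l * s]"
      using \<open>\<rho> \<noteq> 0\<close> B_at by (intro L_at[OF refl]) (auto simp: Z sgn_if)
    moreover have "T2 = \<bar>- sgn \<rho> * T2 - 0\<bar>"
      using \<open>\<rho> \<noteq> 0\<close> T2_pos by (simp add: sgn_if)
    ultimately show "\<exists>t1 t2. L t1 = vector [l, 0, 0] \<and> L t2 = vector [l * 0, l * c, l * s] \<and> T2 = \<bar>t2 - t1\<bar>"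
      using \<open>L 0 = vector [l, 0, 0]\<close> by blast
  next
    fix t1 t2 assume ends: "L t1 = vector [l, 0, 0]" "L t2 = vector [l * 0, l * c, l * s]"
    obtain m :: int where m: "even m" "t1 = m * T2" using at_start[OF ends(1)] by blast
    obtain n :: int where n: "odd n" "t2 = n * T2" using at_turn[OF ends(2)] by blast
    from m(1) n(1) have "1 \<le> \<bar>n - m\<bar>" by presburger
    then have "1 * T2 \<le> \<bar>n - m\<bar> * T2" using T2_pos by (intro mult_right_mono) linarith+
    also have "\<dots> = \<bar>t2 - t1\<bar>" using T2_pos by (simp add: m n abs_mult flip: left_diff_distrib)
    finally show "T2 \<le> \<bar>t2 - t1\<bar>" by simp
  qed
  have arrival: "is_first_arrival_time L (l *\<^sub>R vector [0, cos \<theta>max, - sgn \<rho> * sin \<theta>max]) T2"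
    unfolding is_first_arrival_time_def end_point s_def[symmetric]
  proof (intro conjI allI impI)
    show "L T2 = vector [l * 0, l * c, l * (- sgn \<rho> * s)]"
      using B_at by (intro L_at[of _ 1]) (auto simp: Z)
  next
    fix t assume "0 \<le> t" and "end": "L t = vector [l * 0, l * c, l * (- sgn \<rho> * s)]"
    obtain n :: int where "odd n" and t: "t = n * T2" using at_turn[OF "end"] by blast
    have "0 \<le> n" using \<open>0 \<le> t\<close> T2_pos unfolding t by (simp add: zero_le_mult_iff)
    with \<open>odd n\<close> have "1 \<le> n" by presburger
    then have "1 * T2 \<le> n * T2" using T2_pos by (intro mult_right_mono) linarith+
    then show "T2 \<le> t" by (simp add: t)
  qed (use T2_pos in simp)
  have period: "l / I1 * T2 = 2 * k / (s * \<bar>\<gamma>\<bar>) * elliptic_K (k\<^sup>2)"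
    using assms(1,5) by (simp add: T2_def T_def \<omega>_def field_simps)
  show ?thesis
    by (rule exI[of _ \<theta>max], rule exI[of _ s], rule exI[of _ k], rule exI[of _ T2], intro conjI allI impI)
      (rule attained bound cos_max[unfolded c_def] s_def s_pos inverse k_pos k2 transit arrival period)+
qed

end
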